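(* Let $T\in\mathcal{L}(\ell_\infty)$ be a strictly singular operator. Then $T$ is a commutator.
   Context: $\mathcal{L}(\ell_\infty)$ is the algebra of bounded linear operators on $\ell_\infty$. An operator is strictly singular if its restriction to no infinite-dimensional closed subspace is an isomorphism onto its image. $T$ is a commutator if $T=AB-BA$ for some $A,B\in\mathcal{L}(\ell_\infty)$. *)

theory Defs
  imports "HOL-Analysis.Analysis"
begin

text \<open>
  The scalar field is a type of sort \<open>{real_normed_field, euclidean_space}\<close>, of which
  \<open>real\<close> and \<open>complex\<close> are instances. They are the only ones up to isometric
  isomorphism (Gelfand--Mazur), so a statement that is polymorphic in this sort covers the
  real and the complex \<open>\<ell>\<^sub>\<infinity>\<close>.

  The topology of \<open>nat\<close> is discrete, hence the bounded continuous functions on \<open>nat\<close>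
  are all the bounded scalar sequences; their library norm is the supremum norm.
\<close>

type_synonym 'k linf = "nat \<Rightarrow>\<^sub>C 'k"

text \<open>
  The library provides only real scalar multiplication on \<open>'k linf\<close>, and its bounded
  linear maps are the real-linear ones. Linearity over the scalar field \<open>'k\<close> therefore
  needs the multiplication by elements of \<open>'k\<close>.
\<close>

definition scale_linf ::
  "'k::{real_normed_field,euclidean_space} \<Rightarrow> 'k linf \<Rightarrow> 'k linf" where
  "scale_linf c x = Bcontfun (\<lambda>n. c * apply_bcontfun x n)"

lemma apply_scale_linf [simp]:
  "apply_bcontfun (scale_linf c x) n = c * apply_bcontfun x n"
proof -
  have "bounded (range (apply_bcontfun x))"
    by simp
  then obtain b where b: "\<And>n. norm (apply_bcontfun x n) \<le> b"
    by (auto simp: bounded_iff)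
  have "norm (c * apply_bcontfun x n) \<le> norm c * b" for n
    by (simp add: norm_mult b mult_left_mono)
  then have "(\<lambda>n. c * apply_bcontfun x n) \<in> bcontfun"
    by (auto simp: bcontfun_def bounded_iff)
  then show ?thesis
    by (simp add: scale_linf_def Bcontfun_inverse)
qed

global_interpretation linf: vector_space
  "scale_linf :: 'k::{real_normed_field,euclidean_space} \<Rightarrow> 'k linf \<Rightarrow> 'k linf"
  by unfold_locales (auto intro!: bcontfun_eqI simp: algebra_simps)

lemma scale_linf_of_real: "scale_linf (of_real r) x = r *\<^sub>R x"
  by (rule bcontfun_eqI) (simp add: scaleR_conv_of_real)

definition linf_operators ::
  "('k::{real_normed_field,euclidean_space} linf \<Rightarrow>\<^sub>L 'k linf) set" where
  "linf_operators = {T. \<forall>c x. blinfun_apply T (scale_linf c x) = scale_linf c (blinfun_apply T x)}"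

definition infinite_dimensional ::
  "'k::{real_normed_field,euclidean_space} linf set \<Rightarrow> bool" where
  "infinite_dimensional M \<longleftrightarrow> (\<nexists>B. finite B \<and> linf.span B = M)"

text \<open>
  The inverse of a linear bijection is linear, so that for a linear \<open>T\<close> and a subspace
  \<open>M\<close> the restriction of \<open>T\<close> to \<open>M\<close> is an isomorphism of normed spaces onto its
  image exactly if it is a homeomorphism onto its image.
\<close>

definition strictly_singular ::
  "('k::{real_normed_field,euclidean_space} linf \<Rightarrow>\<^sub>L 'k linf) \<Rightarrow> bool" where
  "strictly_singular T \<longleftrightarrow>
     \<not> (\<exists>M. linf.subspace M \<and> closed M \<and> infinite_dimensional M \<and>
           (\<exists>S. homeomorphism M (blinfun_apply T ` M) (blinfun_apply T) S))"

definition is_commutator ::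
  "('k::{real_normed_field,euclidean_space} linf \<Rightarrow>\<^sub>L 'k linf) \<Rightarrow> bool" where
  "is_commutator T \<longleftrightarrow>
     (\<exists>A\<in>linf_operators. \<exists>B\<in>linf_operators. T = (A o\<^sub>L B) - (B o\<^sub>L A))"

end

theory Submission
  imports Defs
begin

text \<open>
  A strictly singular operator \<open>T\<close> is small after composition with a suitable quotient map of
  \<open>\<ell>\<^sub>\<infinity>\<close> onto itself, and this leaves enough room to write \<open>T\<close> as a commutator with a shift.

  The shift argument (\<open>commutator_of_row_decay\<close>) is the following. Let \<open>V\<close> be an operator with right
  inverse \<open>J\<close>, and regard the values of \<open>V\<close> as elements of \<open>\<ell>\<^sub>\<infinity>(\<nat> \<times> \<nat>)\<close>, that is, as sequences of
  rows. Then there is a shift \<open>R\<close> with left inverse \<open>L\<close> that moves the kernel of \<open>V\<close> into row \<open>0\<close>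
  and each row into the next one. If row \<open>k\<close> of \<open>V T\<close> has norm at most \<open>2\<^sup>-\<^sup>k\<close>, the
  equation \<open>W - R W L = T\<close> has a bounded solution, and \<open>T = (W L) R - R (W L)\<close>.

  It remains to find \<open>V\<close>. Its coordinates are signed averages over disjoint blocks of coordinates;
  such a \<open>V\<close> has an obvious right inverse. So the analytic core (\<open>small_signed_average\<close>) is that \<open>T\<close>,
  followed by a suitable signed average over a suitable number of consecutive coordinates, has norm as
  small as desired. This is where strict singularity enters. Regard the rows \<open>x \<mapsto> (T x)(i)\<close> as
  finitely additive measures on the subsets of \<open>\<nat>\<close>. If rows \<open>i\<^sub>n\<close> had variation bounded away from \<open>0\<close> on
  disjoint sets \<open>A\<^sub>n\<close>, Rosenthal's matrix lemma would yield a copy of \<open>c\<^sub>0\<close> on which \<open>T\<close> is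
  an isomorphism (\<open>strictly_singular_exhaustive\<close>). Hence the rows are uniformly strongly additive, and
  finitely many of them control all the others (\<open>strictly_singular_control\<close>). On the other hand, if
  all signed averages of \<open>n\<close> rows were large, Bessel's inequality for the Rademacher functions would
  produce sets of uniformly bounded overlap, one for each of the \<open>n\<close> rows, whose variations add up to
  at least a fixed multiple of \<open>n\<close>. For finitely many controlling measures of finite total
  variation this is impossible when \<open>n\<close> is large.
\<close>

section \<open>Bounded sequences and operators given by coordinates\<close>

lemma norm_coord_le:
  fixes x :: "'k::{real_normed_field,euclidean_space} linf"
  shows "norm (apply_bcontfun x n) \<le> norm x"
  by (rule norm_bounded)

lemma apply_Bcontfun_bounded:
  fixes f :: "nat \<Rightarrow> 'k::{real_normed_field,euclidean_space}"
  assumes "\<And>n. norm (f n) \<le> b"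
  shows "apply_bcontfun (Bcontfun f) = f"
proof -
  have "f \<in> bcontfun"
    using assms by (auto simp: bcontfun_def bounded_iff)
  then show ?thesis
    by (simp add: Bcontfun_inverse)
qed

lemma apply_bcontfun_sum:
  "apply_bcontfun (\<Sum>i\<in>I. x i) n = (\<Sum>i\<in>I. apply_bcontfun (x i) n)"
  for x :: "'i \<Rightarrow> 'k::{real_normed_field,euclidean_space} linf"
  by (induction I rule: infinite_finite_induct) auto

lemma norm_scale_linf [simp]:
  fixes x :: "'k::{real_normed_field,euclidean_space} linf"
  shows "norm (scale_linf c x) = norm c * norm x"
proof -
  have le: "norm (scale_linf c x) \<le> norm c * norm x" for c :: 'k and x
    by (rule norm_bound) (simp add: norm_mult mult_left_mono norm_coord_le)
  have "norm c * norm x \<le> norm (scale_linf c x)"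
  proof (cases "c = 0")
    case False
    have "norm x = norm (scale_linf (inverse c) (scale_linf c x))"
      using False by simp
    also have "\<dots> \<le> inverse (norm c) * norm (scale_linf c x)"
      using le[of "inverse c" "scale_linf c x"] by (simp only: norm_inverse)
    finally show ?thesis
      using False by (simp add: field_simps)
  qed simp
  with le show ?thesis
    by (rule antisym)
qed

lemma operator_scale:
  assumes "T \<in> linf_operators"
  shows "blinfun_apply T (scale_linf c x) = scale_linf c (blinfun_apply T x)"
  using assms by (simp add: linf_operators_def)

lemma norm_operator_coord_le:
  fixes T :: "'k::{real_normed_field,euclidean_space} linf \<Rightarrow>\<^sub>L 'k linf"
  shows "norm (apply_bcontfun (blinfun_apply T x) i) \<le> norm T * norm x"
  by (rule order_trans[OF norm_coord_le norm_blinfun])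

lemma operator_compose:
  "A \<in> linf_operators \<Longrightarrow> B \<in> linf_operators \<Longrightarrow> A o\<^sub>L B \<in> linf_operators"
  by (simp add: linf_operators_def)

lemma operator_add:
  "A \<in> linf_operators \<Longrightarrow> B \<in> linf_operators \<Longrightarrow> A + B \<in> linf_operators"
  by (simp add: linf_operators_def blinfun.add_left linf.scale_right_distrib)

lemma operator_diff:
  "A \<in> linf_operators \<Longrightarrow> B \<in> linf_operators \<Longrightarrow> A - B \<in> linf_operators"
  by (simp add: linf_operators_def blinfun.diff_left linf.scale_right_diff_distrib)

lemma operator_id: "id_blinfun \<in> linf_operators"
  by (simp add: linf_operators_def)

text \<open>
  Every bounded operator below is written down coordinate by coordinate. A map that commutes
  with \<^const>\<open>scale_linf\<close> is also real homogeneous, by the embedding of the reals in the scalar field, so additivity, homogeneity and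
  a uniform bound on the coordinates suffice.
\<close>

lemma operator_from_coordinates:
  fixes f :: "'k::{real_normed_field,euclidean_space} linf \<Rightarrow> nat \<Rightarrow> 'k"
  assumes add: "\<And>x y n. f (x + y) n = f x n + f y n"
    and scale: "\<And>c x n. f (scale_linf c x) n = c * f x n"
    and bound: "\<And>x n. norm (f x n) \<le> b * norm x"
  obtains A where "A \<in> linf_operators"
    and "\<And>x n. apply_bcontfun (blinfun_apply A x) n = f x n"
proof -
  have app: "apply_bcontfun (Bcontfun (f x)) n = f x n" for x n
    by (rule fun_cong[OF apply_Bcontfun_bounded[OF bound]])
  have "bounded_linear (\<lambda>x. Bcontfun (f x))"
  proof (rule bounded_linear_intro)
    show "Bcontfun (f (x + y)) = Bcontfun (f x) + Bcontfun (f y)" for x y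
      by (rule bcontfun_eqI) (simp add: app add)
    show "Bcontfun (f (r *\<^sub>R x)) = r *\<^sub>R Bcontfun (f x)" for r x
      by (rule bcontfun_eqI)
        (unfold scale_linf_of_real[symmetric], unfold app scale apply_scale_linf, rule refl)
    show "norm (Bcontfun (f x)) \<le> norm x * b" for x
      by (rule norm_bound) (simp add: app bound mult.commute)
  qed
  then have "blinfun_apply (Blinfun (\<lambda>x. Bcontfun (f x))) = (\<lambda>x. Bcontfun (f x))"
    by (rule bounded_linear_Blinfun_apply)
  then show ?thesis
    by (intro that[of "Blinfun (\<lambda>x. Bcontfun (f x))"])
      (auto simp: linf_operators_def app scale intro!: bcontfun_eqI)
qed

lemma rotate_to_norm:
  fixes z :: "'k::real_normed_field"
  obtains \<theta> where "norm \<theta> = 1" and "\<theta> * z = of_real (norm z)"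
proof (cases "z = 0")
  case False
  then show ?thesis
    by (intro that[of "of_real (norm z) / z"]) (auto simp: norm_divide)
qed (use that[of 1] in simp)

section \<open>A criterion for commutators\<close>

text \<open>
  If \<open>L R = 1\<close> and \<open>T = W - R W L\<close>, then \<open>T = (W L) R - R (W L)\<close>; formally \<open>W\<close> is the sum of the
  operators \<open>R\<^sup>n T L\<^sup>n\<close>. The pair \<open>V, J\<close> splits the space into the kernel of \<open>V\<close> and a copy
  of \<open>\<ell>\<^sub>\<infinity>(\<nat> \<times> \<nat>)\<close>, read as a sequence of rows numbered by \<open>k\<close>. The operator \<open>R\<close> stores the
  kernel component in row \<open>0\<close> and moves row \<open>k\<close> to row \<open>k + 1\<close>; its left inverse \<open>L\<close> undoes this.
  The kernel is only embedded into row \<open>0\<close>, as a subspace of \<open>\<ell>\<^sub>\<infinity>\<close>, so no isomorphism between the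
  kernel and \<open>\<ell>\<^sub>\<infinity>\<close> has to be found.
  
  In row \<open>k\<close> the formal sum for \<open>W\<close> has only \<open>k + 2\<close> terms, namely row \<open>k - m\<close> of \<open>T L\<^sup>m\<close> for
  \<open>m \<le> k\<close> and the kernel component of \<open>T L\<^sup>k\<^sup>+\<^sup>1\<close>. The decay of the rows of \<open>T\<close> and the boundedness
  of the powers of \<open>L\<close> bound these finite sums uniformly in \<open>k\<close>, so that \<open>W\<close> is a bounded operator.
\<close>

lemma commutator_of_row_decay:
  fixes T V J :: "'k::{real_normed_field,euclidean_space} linf \<Rightarrow>\<^sub>L 'k linf"
  assumes T: "T \<in> linf_operators" and V: "V \<in> linf_operators" and J: "J \<in> linf_operators"
    and VJ: "V o\<^sub>L J = id_blinfun"
    and decay: "\<And>x k n. norm (apply_bcontfun (V (T x)) (prod_encode (k, n))) \<le> (1/2)^k * norm x"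
  shows "is_commutator T"
proof -
  obtain top :: "'k linf \<Rightarrow>\<^sub>L 'k linf" where top: "top \<in> linf_operators"
    and top_app: "\<And>x n. apply_bcontfun (top x) n = apply_bcontfun x (prod_encode (0, n))"
    by (rule operator_from_coordinates[of "\<lambda>x n. apply_bcontfun x (prod_encode (0, n))" 1])
      (auto simp: norm_coord_le)
  obtain pop :: "'k linf \<Rightarrow>\<^sub>L 'k linf" where pop: "pop \<in> linf_operators"
    and pop_app: "\<And>x m. apply_bcontfun (pop x) m =
      (case prod_decode m of (k, n) \<Rightarrow> apply_bcontfun x (prod_encode (Suc k, n)))"
    by (rule operator_from_coordinates[of "\<lambda>x m. case prod_decode m of (k, n) \<Rightarrow>
        apply_bcontfun x (prod_encode (Suc k, n))" 1])
      (auto simp: norm_coord_le split: prod.split)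
  obtain inj0 :: "'k linf \<Rightarrow>\<^sub>L 'k linf" where inj0: "inj0 \<in> linf_operators"
    and inj0_app: "\<And>x m. apply_bcontfun (inj0 x) m =
      (case prod_decode m of (0, n) \<Rightarrow> apply_bcontfun x n | (Suc k, n) \<Rightarrow> 0)"
    by (rule operator_from_coordinates[of "\<lambda>x m. case prod_decode m of
        (0, n) \<Rightarrow> apply_bcontfun x n | (Suc k, n) \<Rightarrow> 0" 1])
      (auto simp: norm_coord_le split: prod.split nat.split)
  obtain shift :: "'k linf \<Rightarrow>\<^sub>L 'k linf" where shift: "shift \<in> linf_operators"
    and shift_app: "\<And>x m. apply_bcontfun (shift x) m =
      (case prod_decode m of (0, n) \<Rightarrow> 0 | (Suc k, n) \<Rightarrow> apply_bcontfun x (prod_encode (k, n)))"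
    by (rule operator_from_coordinates[of "\<lambda>x m. case prod_decode m of
        (0, n) \<Rightarrow> 0 | (Suc k, n) \<Rightarrow> apply_bcontfun x (prod_encode (k, n))" 1])
      (auto simp: norm_coord_le split: prod.split nat.split)
  have coord_eqI: "x = y" if "\<And>k n. apply_bcontfun x (prod_encode (k, n)) =
      apply_bcontfun y (prod_encode (k, n))" for x y :: "'k linf"
  proof (rule bcontfun_eqI)
    fix m
    show "apply_bcontfun x m = apply_bcontfun y m"
      using that[of "fst (prod_decode m)" "snd (prod_decode m)"] by simp
  qed
  have top_inj0: "top (inj0 x) = x" and top_shift: "top (shift x) = 0"
    and pop_inj0: "pop (inj0 x) = 0" and pop_shift: "pop (shift x) = x" for x
    by (auto intro!: coord_eqI simp: top_app pop_app inj0_app shift_app)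
  have norm_pop: "norm (pop x) \<le> norm x" for x
    by (rule norm_bound) (simp add: pop_app norm_coord_le split: prod.split)
  have VJ': "V (J x) = x" for x
    using arg_cong[OF VJ, of "\<lambda>A. blinfun_apply A x"] by simp
  \<comment> \<open>\<open>Q\<close> is the projection onto the kernel of \<open>V\<close> along the range of \<open>J\<close>.\<close>
  define Q where "Q = id_blinfun - (J o\<^sub>L V)"
  have Q: "Q \<in> linf_operators"
    unfolding Q_def by (intro operator_diff operator_compose operator_id V J)
  have Q_app: "Q x = x - J (V x)" for x
    by (simp add: Q_def blinfun.diff_left)
  have VQ: "V (Q x) = 0" and QJ: "Q (J x) = 0" and QQ: "Q (Q x) = Q x" for x
    by (simp_all add: Q_app VJ' blinfun.diff_right)
  define R where "R = J o\<^sub>L ((inj0 o\<^sub>L Q) + (shift o\<^sub>L V))"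
  define K where "K = (Q o\<^sub>L top) + (J o\<^sub>L pop)"
  define L where "L = K o\<^sub>L V"
  have R: "R \<in> linf_operators"
    unfolding R_def by (intro operator_add operator_compose Q J V inj0 shift)
  have L: "L \<in> linf_operators"
    unfolding L_def K_def by (intro operator_add operator_compose Q J V top pop)
  have R_app: "R x = J (inj0 (Q x) + shift (V x))" for x
    by (simp add: R_def blinfun.add_left)
  have K_app: "K y = Q (top y) + J (pop y)" for y
    by (simp add: K_def blinfun.add_left)
  have L_app: "L x = K (V x)" for x
    by (simp add: L_def)
  have LR: "L (R x) = x" for x
    by (simp add: R_app L_app K_app VJ' blinfun.add_right top_inj0 top_shift pop_inj0 pop_shift QQ)
      (simp add: Q_app)
  have VL: "V (L x) = pop (V x)" for x
    by (simp add: L_app K_app blinfun.add_right VQ VJ')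
  define Lp where "Lp m = (blinfun_apply L ^^ m)" for m
  have Lp_0: "Lp 0 x = x" and Lp_Suc: "Lp (Suc m) x = L (Lp m x)"
    and Lp_Suc': "Lp (Suc m) x = Lp m (L x)" for m x
    by (simp_all add: Lp_def funpow_swap1)
  have Lp_add: "Lp m (x + y) = Lp m x + Lp m y" for m x y
    by (induction m) (simp_all add: Lp_0 Lp_Suc blinfun.add_right)
  have Lp_scale: "Lp m (scale_linf c x) = scale_linf c (Lp m x)" for m c x
    by (induction m) (simp_all add: Lp_0 Lp_Suc operator_scale[OF L])
  have norm_VLp: "norm (V (Lp m x)) \<le> norm V * norm x" for m x
  proof (induction m)
    case (Suc m)
    then show ?case
      using norm_pop[of "V (Lp m x)"] by (simp add: Lp_Suc VL)
  qed (simp add: Lp_0 norm_blinfun)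
  \<comment> \<open>One bound for all powers of \<open>L\<close>: for \<open>m > 0\<close> one has \<open>L\<^sup>m = K pop\<^sup>m\<^sup>-\<^sup>1 V\<close>, and \<open>pop\<close> is a contraction.\<close>
  define b where "b = 1 + norm K * norm V"
  have norm_Lp: "norm (Lp m x) \<le> b * norm x" for m x
  proof (cases m)
    case 0
    then show ?thesis by (simp add: Lp_0 b_def algebra_simps)
  next
    case (Suc m')
    have "norm (Lp m x) \<le> norm K * norm (V (Lp m' x))"
      by (simp add: Suc Lp_Suc L_app norm_blinfun)
    also have "\<dots> \<le> norm K * (norm V * norm x)"
      by (intro mult_left_mono norm_VLp) simp
    finally show ?thesis
      by (simp add: b_def algebra_simps add_increasing)
  qed
  have b0: "b \<ge> 0"
    by (simp add: b_def)
  \<comment> \<open>\<open>y x k\<close> is row \<open>k\<close> of the formal sum of the \<open>R\<^sup>m T L\<^sup>m\<close>, applied to \<open>x\<close>.\<close>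
  define y where "y x k n = (\<Sum>m\<le>k. apply_bcontfun (V (T (Lp m x))) (prod_encode (k - m, n)))
      + apply_bcontfun (Q (T (Lp (Suc k) x))) n" for x k n
  have y_bound: "norm (y x k n) \<le> (2 * b + norm Q * (norm T * b)) * norm x" for x k n
  proof -
    have "norm (\<Sum>m\<le>k. apply_bcontfun (V (T (Lp m x))) (prod_encode (k - m, n)))
        \<le> (\<Sum>m\<le>k. (1/2)^(k - m) * (b * norm x))"
      by (intro sum_norm_le order_trans[OF decay] mult_left_mono norm_Lp) auto
    also have "\<dots> = (\<Sum>m\<le>k. (1/2)^m) * (b * norm x)"
      using sum.nat_diff_reindex[of "\<lambda>m. (1/2::real)^m" "Suc k"]
      by (simp add: lessThan_Suc_atMost flip: sum_distrib_right)
    also have "\<dots> \<le> 2 * (b * norm x)"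
    proof (rule mult_right_mono)
      have "(\<Sum>m\<le>k. (1/2::real)^m) = 2 - (1/2)^k"
        by (induction k) auto
      then show "(\<Sum>m\<le>k. (1/2::real)^m) \<le> 2" by simp
    qed (simp add: b0)
    finally have 1: "norm (\<Sum>m\<le>k. apply_bcontfun (V (T (Lp m x))) (prod_encode (k - m, n)))
        \<le> 2 * (b * norm x)" .
    have "norm (apply_bcontfun (Q (T (Lp (Suc k) x))) n) \<le> norm Q * (norm T * (b * norm x))"
      by (intro order_trans[OF norm_operator_coord_le] order_trans[OF norm_blinfun]
          mult_left_mono norm_Lp) auto
    with 1 show ?thesis
      unfolding y_def by (intro order_trans[OF norm_triangle_ineq]) (simp add: algebra_simps)
  qed
  obtain Y :: "'k linf \<Rightarrow>\<^sub>L 'k linf" where Y: "Y \<in> linf_operators"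
    and Y_app: "\<And>x m. apply_bcontfun (Y x) m = (case prod_decode m of (k, n) \<Rightarrow> y x k n)"
  proof (rule operator_from_coordinates[of "\<lambda>x m. case prod_decode m of (k, n) \<Rightarrow> y x k n"
        "2 * b + norm Q * (norm T * b)"])
    fix x x' :: "'k linf" and c m
    show "(case prod_decode m of (k, n) \<Rightarrow> y (x + x') k n) =
        (case prod_decode m of (k, n) \<Rightarrow> y x k n) + (case prod_decode m of (k, n) \<Rightarrow> y x' k n)"
      by (simp add: y_def Lp_add blinfun.add_right sum.distrib split: prod.split)
    show "(case prod_decode m of (k, n) \<Rightarrow> y (scale_linf c x) k n) =
        c * (case prod_decode m of (k, n) \<Rightarrow> y x k n)"
      by (simp add: y_def Lp_scale operator_scale[OF V] operator_scale[OF T] operator_scale[OF Q]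
          sum_distrib_left distrib_left split: prod.split)
    show "norm (case prod_decode m of (k, n) \<Rightarrow> y x k n)
        \<le> (2 * b + norm Q * (norm T * b)) * norm x"
      using y_bound by (simp split: prod.split)
  qed blast
  \<comment> \<open>The row form of \<open>W = T + R W L\<close>.\<close>
  have Y_eq: "Y x = V (T x) + inj0 (Q (T (L x))) + shift (Y (L x))" for x
  proof (rule coord_eqI)
    fix k n
    show "apply_bcontfun (Y x) (prod_encode (k, n)) =
      apply_bcontfun (V (T x) + inj0 (Q (T (L x))) + shift (Y (L x))) (prod_encode (k, n))"
    proof (cases k)
      case (Suc k')
      have "(\<Sum>m\<le>Suc k'. apply_bcontfun (V (T (Lp m x))) (prod_encode (Suc k' - m, n))) =
          apply_bcontfun (V (T x)) (prod_encode (Suc k', n)) +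
          (\<Sum>m\<le>k'. apply_bcontfun (V (T (Lp m (L x)))) (prod_encode (k' - m, n)))"
        by (subst sum.atMost_Suc_shift) (simp add: Lp_0 Lp_Suc')
      then show ?thesis
        by (simp add: Suc Y_app inj0_app shift_app y_def) (simp add: Lp_Suc')
    qed (simp add: Y_app inj0_app shift_app y_def Lp_0 Lp_Suc)
  qed
  define W where "W = (Q o\<^sub>L T) + (J o\<^sub>L Y)"
  have W: "W \<in> linf_operators"
    unfolding W_def by (intro operator_add operator_compose Q J T Y)
  have W_app: "W x = Q (T x) + J (Y x)" for x
    by (simp add: W_def blinfun.add_left)
  have QW: "Q (W x) = Q (T x)" and VW: "V (W x) = Y x" for x
    by (simp_all add: W_app blinfun.add_right QQ QJ VQ VJ')
  have "T x = W (L (R x)) - R (W (L x))" for x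
  proof -
    have "W x - R (W (L x)) = Q (T x) + J (Y x - inj0 (Q (T (L x))) - shift (Y (L x)))"
      by (simp add: R_app QW VW W_app[of x] blinfun.add_right blinfun.diff_right)
    also have "\<dots> = Q (T x) + J (V (T x))"
      by (subst Y_eq) simp
    finally show ?thesis
      by (simp add: LR Q_app)
  qed
  then have "T = ((W o\<^sub>L L) o\<^sub>L R) - (R o\<^sub>L (W o\<^sub>L L))"
    by (intro blinfun_eqI) (simp add: blinfun.diff_left)
  then show ?thesis
    unfolding is_commutator_def using operator_compose[OF W L] R by blast
qed

section \<open>Two finite inequalities\<close>

text \<open>
  Split an infinite index set into infinitely many infinite pieces. If no piece is good, choose in
  each piece one row \<open>n\<close> and finitely many columns of the same piece on which the row sum exceeds
  \<open>e\<close>. On the set of chosen rows these columns do not occur, so passing to this set lowers the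
  bound on all row sums by \<open>e\<close>. This can happen only finitely often.
\<close>

lemma rosenthal_matrix_lemma:
  fixes a :: "nat \<Rightarrow> nat \<Rightarrow> real"
  assumes nonneg: "\<And>n k. a n k \<ge> 0"
    and bound: "\<And>n F. finite F \<Longrightarrow> (\<Sum>k\<in>F. a n k) \<le> C"
    and e: "e > 0"
  obtains N where "infinite N" and "\<And>n F. n \<in> N \<Longrightarrow> finite F \<Longrightarrow> F \<subseteq> N - {n} \<Longrightarrow> (\<Sum>k\<in>F. a n k) \<le> e"
proof -
  define ok where "ok N n \<longleftrightarrow> (\<forall>F. finite F \<longrightarrow> F \<subseteq> N - {n} \<longrightarrow> (\<Sum>k\<in>F. a n k) \<le> e)" for N n
  have thin: "\<exists>N'. infinite N' \<and> N' \<subseteq> N \<and>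
      (\<forall>n\<in>N'. ok N' n)"
    if "infinite N" and "\<And>n F. n \<in> N \<Longrightarrow> finite F \<Longrightarrow> F \<subseteq> N \<Longrightarrow> (\<Sum>k\<in>F. a n k) \<le> real p * e"
    for N :: "nat set" and p
    using that
  proof (induction p arbitrary: N)
    case 0
    have "(\<Sum>k\<in>F. a n k) \<le> e" if "n \<in> N" "finite F" "F \<subseteq> N - {n}" for n F
    proof -
      have "F \<subseteq> N"
        using that(3) by blast
      then show ?thesis
        using "0.prems"(2)[OF that(1,2)] e by simp
    qed
    then have "\<forall>n\<in>N. ok N n"
      by (simp add: ok_def)
    then show ?case
      using "0.prems"(1) by blast
  next
    case (Suc p)
    \<comment> \<open>The pieces \<open>M q\<close>, obtained from a bijection of the index set with \<open>\<nat> \<times> \<nat>\<close>.\<close>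
    define M where "M q = (\<lambda>r. enumerate N (prod_encode (q, r))) ` UNIV" for q :: nat
    have inj: "inj (enumerate N)"
      using Suc.prems(1) by (simp add: strict_mono_enumerate strict_mono_imp_inj_on)
    have inf_M: "infinite (M q)" for q
      unfolding M_def using inj
      by (intro range_inj_infinite injI) (simp add: inj_eq)
    have M_sub: "M q \<subseteq> N" for q
      unfolding M_def using Suc.prems(1) by (auto intro: enumerate_in_set)
    have M_disj: "M q \<inter> M q' = {}" if "q \<noteq> q'" for q q'
      using that inj by (auto simp: M_def inj_eq)
    show ?case
    proof (cases "\<exists>q. \<forall>n\<in>M q. ok (M q) n")
      case True
      then obtain q where "\<forall>n\<in>M q. ok (M q) n"
        by (rule exE)
      with inf_M[of q] M_sub[of q] show ?thesis
        by (intro exI[of _ "M q"] conjI)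
    next
      case False
      then have "\<forall>q. \<exists>n. n \<in> M q \<and> \<not> ok (M q) n"
        by blast
      from choice[OF this] obtain n where n: "\<And>q. n q \<in> M q" "\<And>q. \<not> ok (M q) (n q)"
        by blast
      from n(2) have "\<forall>q. \<exists>F. finite F \<and> F \<subseteq> M q - {n q} \<and> (\<Sum>k\<in>F. a (n q) k) > e"
        by (simp add: ok_def not_le)
      from choice[OF this] obtain F
        where "\<forall>q. finite (F q) \<and> F q \<subseteq> M q - {n q} \<and> (\<Sum>k\<in>F q. a (n q) k) > e"
        by (rule exE)
      then have F: "finite (F q)" "F q \<subseteq> M q - {n q}" "(\<Sum>k\<in>F q. a (n q) k) > e" for q
        by simp_all
      note nF = n(1) F
      have "inj n"
      proof (rule injI)
        fix q q' assume "n q = n q'"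
        then show "q = q'"
          using nF(1)[of q] nF(1)[of q'] M_disj[of q q'] by auto
      qed
      then have "infinite (range n)"
        by (rule range_inj_infinite)
      moreover have "(\<Sum>k\<in>G. a m k) \<le> real p * e"
        if m: "m \<in> range n" and G: "finite G" "G \<subseteq> range n" for m G
      proof -
        obtain q where q: "m = n q"
          using m by blast
        have "G \<inter> F q = {}"
        proof (rule ccontr)
          assume "G \<inter> F q \<noteq> {}"
          then obtain q' where "n q' \<in> F q"
            using G by blast
          then show False
            using nF(1)[of q'] nF(3)[of q] M_disj[of q q'] by (cases "q = q'") auto
        qed
        then have "(\<Sum>k\<in>G. a m k) + (\<Sum>k\<in>F q. a m k) = (\<Sum>k\<in>G \<union> F q. a m k)"
          using G nF(2) by (simp add: sum.union_disjoint)
        also have "\<dots> \<le> real (Suc p) * e"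
        proof (rule Suc.prems(2))
          show "m \<in> N"
            using q nF(1)[of q] M_sub[of q] by auto
          show "finite (G \<union> F q)"
            using G(1) nF(2)[of q] by simp
          have "G \<subseteq> N"
            using G(2) nF(1) M_sub by (auto dest: subsetD)
          then show "G \<union> F q \<subseteq> N"
            using nF(3)[of q] M_sub[of q] by auto
        qed
        finally show ?thesis
          using nF(4)[of q] q by (simp add: algebra_simps)
      qed
      ultimately have "\<exists>N'. infinite N' \<and> N' \<subseteq> range n \<and>
          (\<forall>n\<in>N'. ok N' n)"
        by (rule Suc.IH)
      then obtain N' where N': "infinite N'" "N' \<subseteq> range n"
          "\<forall>n\<in>N'. ok N' n"
        by (elim exE conjE)
      have "range n \<subseteq> N"
        using nF(1) M_sub by blast
      with N' show ?thesis
        by (intro exI[of _ N'] conjI) auto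
    qed
  qed
  obtain p :: nat where "C / e \<le> real p"
    using real_arch_simple by blast
  then have "C \<le> real p * e"
    using e by (simp add: field_simps)
  then have "(\<Sum>k\<in>F. a n k) \<le> real p * e" if "finite F" for n F
    using bound[OF that, of n] by linarith
  then obtain N where "infinite N" "\<forall>n\<in>N. ok N n"
    using thin[of UNIV p] by auto
  then show ?thesis
    by (intro that[of N]) (auto simp: ok_def)
qed

lemma norm_sum_squared_le:
  fixes a :: "'i \<Rightarrow> 'a::real_normed_vector"
  shows "(norm (\<Sum>i\<in>I. a i))\<^sup>2 \<le> real (card I) * (\<Sum>i\<in>I. (norm (a i))\<^sup>2)"
proof -
  have "(norm (\<Sum>i\<in>I. a i))\<^sup>2 \<le> (\<Sum>i\<in>I. norm (a i))\<^sup>2"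
    by (intro power_mono norm_sum) simp
  also have "\<dots> \<le> real (card I) * (\<Sum>i\<in>I. (norm (a i))\<^sup>2)"
    using sum_squared_le_sum_of_squares[of "\<lambda>i. norm (a i)" I]
    by (simp add: mult.commute)
  finally show ?thesis .
qed

text \<open>
  A choice of signs on \<open>B\<close> is encoded by the set \<open>S\<close> of indices with sign \<open>+1\<close>, so that
  \<^term>\<open>Pow B\<close> with the counting measure is the probability space on which the Rademacher functions
  live.
\<close>

definition sign_of :: "'i set \<Rightarrow> 'i \<Rightarrow> real" where
  "sign_of S i = (if i \<in> S then 1 else - 1)"

lemma sign_of_cases: "sign_of S i = 1 \<or> sign_of S i = - 1"
  by (simp add: sign_of_def)

text \<open>
  Bessel's inequality for the Rademacher functions, without normalisation. Induction on \<open>B\<close> avoids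
  orthogonality relations: for a new index \<open>b\<close> the old coefficients see only
  \<open>X (insert b S) + X S\<close>, the new one sees only \<open>X (insert b S) - X S\<close>, and the parallelogram law
  combines the two.
\<close>

lemma bessel_rademacher:
  fixes X :: "'i set \<Rightarrow> 'a::real_inner"
  assumes "finite B"
  shows "(\<Sum>i\<in>B. (norm (\<Sum>S\<in>Pow B. sign_of S i *\<^sub>R X S))\<^sup>2) \<le> 2 ^ card B * (\<Sum>S\<in>Pow B. (norm (X S))\<^sup>2)"
  using assms
proof (induction B arbitrary: X rule: finite_induct)
  case (insert b B)
  have fin: "finite (Pow B)" "finite (insert b ` Pow B)"
    using insert.hyps by simp_all
  have disj: "Pow B \<inter> insert b ` Pow B = {}"
    using insert.hyps by auto
  have inj: "inj_on (insert b) (Pow B)"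
    using insert.hyps by (auto simp: inj_on_def)
  have split: "(\<Sum>S\<in>Pow (insert b B). f S) = (\<Sum>S\<in>Pow B. f (insert b S) + f S)"
    for f :: "'i set \<Rightarrow> 'c::comm_monoid_add"
    using inj by (simp add: Pow_insert sum.union_disjoint[OF fin disj] sum.reindex sum.distrib
        add.commute)
  have "(\<Sum>S\<in>Pow (insert b B). sign_of S b *\<^sub>R X S) = (\<Sum>S\<in>Pow B. X (insert b S) - X S)"
    unfolding split using insert.hyps by (intro sum.cong) (auto simp: sign_of_def)
  then have new: "(norm (\<Sum>S\<in>Pow (insert b B). sign_of S b *\<^sub>R X S))\<^sup>2
      \<le> 2 ^ card B * (\<Sum>S\<in>Pow B. (norm (X (insert b S) - X S))\<^sup>2)"
    using norm_sum_squared_le[of "\<lambda>S. X (insert b S) - X S" "Pow B"] insert.hyps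
    by (simp add: card_Pow)
  have "(\<Sum>S\<in>Pow (insert b B). sign_of S i *\<^sub>R X S) =
      (\<Sum>S\<in>Pow B. sign_of S i *\<^sub>R (X (insert b S) + X S))" if "i \<in> B" for i
    unfolding split using that insert.hyps
    by (intro sum.cong) (auto simp: sign_of_def scaleR_add_right)
  then have old: "(\<Sum>i\<in>B. (norm (\<Sum>S\<in>Pow (insert b B). sign_of S i *\<^sub>R X S))\<^sup>2)
      \<le> 2 ^ card B * (\<Sum>S\<in>Pow B. (norm (X (insert b S) + X S))\<^sup>2)"
    using insert.IH[of "\<lambda>S. X (insert b S) + X S"] by simp
  have par: "(norm (u + v))\<^sup>2 + (norm (u - v))\<^sup>2 = 2 * ((norm u)\<^sup>2 + (norm v)\<^sup>2)" for u v :: 'a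
    by (simp add: power2_norm_eq_inner inner_add_left inner_add_right inner_diff_left
        inner_diff_right)
  have "(\<Sum>i\<in>insert b B. (norm (\<Sum>S\<in>Pow (insert b B). sign_of S i *\<^sub>R X S))\<^sup>2)
      \<le> 2 ^ card B * (\<Sum>S\<in>Pow B. (norm (X (insert b S) + X S))\<^sup>2 + (norm (X (insert b S) - X S))\<^sup>2)"
    using insert.hyps new old by (simp add: sum.distrib distrib_left)
  also have "\<dots> = 2 ^ card (insert b B) * (\<Sum>S\<in>Pow (insert b B). (norm (X S))\<^sup>2)"
    unfolding par split using insert.hyps by (simp add: sum_distrib_left algebra_simps)
  finally show ?case .
qed simp

section \<open>The variation of the rows of an operator\<close>

definition ball_on :: "nat set \<Rightarrow> 'k::{real_normed_field,euclidean_space} linf set" where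
  "ball_on A = {x. \<forall>n. norm (apply_bcontfun x n) \<le> indicator A n}"

text \<open>
  For finitely additive measures \<open>\<mu>\<close>, identified with functionals on \<open>\<ell>\<^sub>\<infinity>\<close>, the total variation of
  \<open>\<mu>\<close> on \<open>A\<close> is the supremum of \<open>|\<mu>(x)|\<close> over the \<open>x\<close> with \<open>|x| \<le> 1\<^sub>A\<close>. This is taken as the
  definition of the variation of the functional \<open>x \<mapsto> (T x)(i)\<close>, the \<open>i\<close>-th row of \<open>T\<close>.
\<close>

definition row_variation ::
  "('k::{real_normed_field,euclidean_space} linf \<Rightarrow>\<^sub>L 'k linf) \<Rightarrow> nat \<Rightarrow> nat set \<Rightarrow> real" where
  "row_variation T i A = (SUP x\<in>ball_on A. norm (apply_bcontfun (blinfun_apply T x) i))"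

definition restrict_linf ::
  "nat set \<Rightarrow> 'k::{real_normed_field,euclidean_space} linf \<Rightarrow> 'k linf" where
  "restrict_linf A x = Bcontfun (\<lambda>n. if n \<in> A then apply_bcontfun x n else 0)"

lemma apply_restrict_linf [simp]:
  "apply_bcontfun (restrict_linf A x) n = (if n \<in> A then apply_bcontfun x n else 0)"
  unfolding restrict_linf_def
  by (subst apply_Bcontfun_bounded[of _ "norm x"]) (auto simp: norm_coord_le)

lemma zero_in_ball_on [simp]: "0 \<in> ball_on A"
  by (simp add: ball_on_def)

lemma ball_on_norm_le_1: "x \<in> ball_on A \<Longrightarrow> norm x \<le> 1"
  by (intro norm_bound) (auto simp: ball_on_def indicator_def intro: order_trans split: if_splits)

lemma ball_on_zero: "x \<in> ball_on A \<Longrightarrow> n \<notin> A \<Longrightarrow> apply_bcontfun x n = 0"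
  by (auto simp: ball_on_def dest: spec[of _ n])

lemma bdd_above_row:
  fixes T :: "'k::{real_normed_field,euclidean_space} linf \<Rightarrow>\<^sub>L 'k linf"
  shows "bdd_above ((\<lambda>x. norm (apply_bcontfun (blinfun_apply T x) i)) ` ball_on A)"
proof (rule bdd_aboveI2)
  fix x :: "'k linf" assume "x \<in> ball_on A"
  then show "norm (apply_bcontfun (blinfun_apply T x) i) \<le> norm T * 1"
    by (intro order_trans[OF norm_operator_coord_le] mult_left_mono ball_on_norm_le_1) auto
qed

lemma row_le_variation: "x \<in> ball_on A \<Longrightarrow> norm (apply_bcontfun (blinfun_apply T x) i) \<le> row_variation T i A"
  unfolding row_variation_def by (rule cSUP_upper[OF _ bdd_above_row])

lemma row_variation_leI:
  "(\<And>x. x \<in> ball_on A \<Longrightarrow> norm (apply_bcontfun (blinfun_apply T x) i) \<le> c) \<Longrightarrow> row_variation T i A \<le> c"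
  unfolding row_variation_def using zero_in_ball_on by (intro cSUP_least) blast+

lemma row_variation_nonneg: "row_variation T i A \<ge> 0"
  using row_le_variation[OF zero_in_ball_on] by simp

lemma row_variation_le_norm: "row_variation T i A \<le> norm T"
proof (rule row_variation_leI)
  fix x :: "'a linf" assume "x \<in> ball_on A"
  then have "norm (apply_bcontfun (blinfun_apply T x) i) \<le> norm T * 1"
    by (intro order_trans[OF norm_operator_coord_le] mult_left_mono ball_on_norm_le_1) auto
  then show "norm (apply_bcontfun (blinfun_apply T x) i) \<le> norm T" by simp
qed

lemma row_variation_witness:
  assumes "c < row_variation T i A"
  obtains x where "x \<in> ball_on A" and "c < norm (apply_bcontfun (blinfun_apply T x) i)"
  using assms row_variation_leI[of A T i c] by force

lemma row_variation_subadditive: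
  assumes "A \<subseteq> D \<union> E"
  shows "row_variation T i A \<le> row_variation T i D + row_variation T i E"
proof (rule row_variation_leI)
  fix x :: "'a linf" assume x: "x \<in> ball_on A"
  have split: "x = restrict_linf D x + restrict_linf (- D) x"
    by (rule bcontfun_eqI) simp
  have le: "norm (apply_bcontfun x n) \<le> 1" for n
    using norm_coord_le[of x n] ball_on_norm_le_1[OF x] by linarith
  have "restrict_linf D x \<in> ball_on D"
    using le by (simp add: ball_on_def)
  moreover have "restrict_linf (- D) x \<in> ball_on E"
    unfolding ball_on_def
  proof (intro CollectI allI)
    fix n
    show "norm (apply_bcontfun (restrict_linf (- D) x) n) \<le> indicator E n"
      using le[of n] ball_on_zero[OF x, of n] assms by (cases "n \<in> A"; cases "n \<in> D") auto
  qed
  ultimately show "norm (apply_bcontfun (blinfun_apply T x) i) \<le> row_variation T i D + row_variation T i E"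
    by (subst split) (simp add: blinfun.add_right,
      intro order_trans[OF norm_triangle_ineq] add_mono row_le_variation)
qed

lemma row_variation_empty [simp]: "row_variation T i {} = 0"
proof (rule antisym[OF row_variation_leI row_variation_nonneg])
  fix x :: "'a linf" assume "x \<in> ball_on {}"
  then have "x = 0"
    by (intro bcontfun_eqI) (simp add: ball_on_zero)
  then show "norm (apply_bcontfun (blinfun_apply T x) i) \<le> 0" by simp
qed

lemma row_variation_mono: "A \<subseteq> D \<Longrightarrow> row_variation T i A \<le> row_variation T i D"
  using row_variation_subadditive[of A D "{}" T i] by simp

lemma row_variation_UN:
  "finite I \<Longrightarrow> row_variation T i (\<Union>k\<in>I. A k) \<le> (\<Sum>k\<in>I. row_variation T i (A k))"
proof (induction I rule: finite_induct)
  case (insert k I)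
  then show ?case
    using row_variation_subadditive[of "\<Union>k\<in>insert k I. A k" "A k" "\<Union>k\<in>I. A k" T i] by simp
qed simp

text \<open>
  Rotating each \<open>x k\<close> by a unimodular scalar makes all the numbers \<open>T (x k) i\<close> nonnegative without
  changing the moduli of the coordinates; the left-hand side is then one coordinate of the image of
  a single vector of norm at most \<open>D\<close>.
\<close>

lemma sum_row_norms_le:
  fixes T :: "'k::{real_normed_field,euclidean_space} linf \<Rightarrow>\<^sub>L 'k linf"
  assumes T: "T \<in> linf_operators"
    and D: "\<And>t. (\<Sum>k\<in>F. norm (apply_bcontfun (x k) t)) \<le> D"
  shows "(\<Sum>k\<in>F. norm (apply_bcontfun (blinfun_apply T (x k)) i)) \<le> norm T * D"
proof -
  define z where "z k = apply_bcontfun (blinfun_apply T (x k)) i" for k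
  have "\<exists>\<theta>. norm \<theta> = 1 \<and> \<theta> * z k = of_real (norm (z k))" for k
    by (rule rotate_to_norm[of "z k"]) blast
  then obtain \<theta> where \<theta>: "\<And>k. norm (\<theta> k) = 1" "\<And>k. \<theta> k * z k = of_real (norm (z k))"
    by metis
  define y where "y = (\<Sum>k\<in>F. scale_linf (\<theta> k) (x k))"
  have "norm y \<le> D"
    unfolding y_def
    by (rule norm_bound, unfold apply_bcontfun_sum, rule order_trans[OF norm_sum])
      (simp add: norm_mult \<theta> D)
  have "apply_bcontfun (blinfun_apply T y) i = (\<Sum>k\<in>F. \<theta> k * z k)"
    by (simp add: y_def blinfun.sum_right apply_bcontfun_sum operator_scale[OF T] z_def)
  also have "\<dots> = of_real (\<Sum>k\<in>F. norm (z k))"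
    by (simp add: \<theta>)
  finally have "(\<Sum>k\<in>F. norm (z k)) = norm (apply_bcontfun (blinfun_apply T y) i)"
    by (simp only: norm_of_real) (simp add: sum_nonneg)
  also have "\<dots> \<le> norm T * D"
    by (intro order_trans[OF norm_operator_coord_le] mult_left_mono \<open>norm y \<le> D\<close>) simp
  finally show ?thesis
    by (simp add: z_def)
qed

lemma sum_ball_on_le:
  assumes "finite F" and "\<And>k. k \<in> F \<Longrightarrow> x k \<in> ball_on (A k)" and "card {k \<in> F. t \<in> A k} \<le> K"
  shows "(\<Sum>k\<in>F. norm (apply_bcontfun (x k) t)) \<le> real K"
proof -
  have "(\<Sum>k\<in>F. norm (apply_bcontfun (x k) t)) \<le> (\<Sum>k\<in>F. indicator (A k) t)"
    using assms(2) by (intro sum_mono) (simp add: ball_on_def)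
  also have "\<dots> = real (card {k \<in> F. t \<in> A k})"
    using assms(1) by (simp add: indicator_def sum.If_cases Int_def)
  finally show ?thesis
    using assms(3) by linarith
qed

text \<open>
  Sets that cover each point at most \<open>K\<close> times have total variation at most \<open>K\<close> times the norm of
  the functional: almost optimal vectors supported by these sets satisfy the hypothesis of
  \<open>sum_row_norms_le\<close> with \<open>D = K\<close>.
\<close>

lemma sum_row_variation_le:
  fixes T :: "'k::{real_normed_field,euclidean_space} linf \<Rightarrow>\<^sub>L 'k linf"
  assumes T: "T \<in> linf_operators" and F: "finite F"
    and overlap: "\<And>t. card {k \<in> F. t \<in> A k} \<le> K"
  shows "(\<Sum>k\<in>F. row_variation T i (A k)) \<le> norm T * real K"
proof (rule field_le_epsilon)
  fix e :: real assume e: "e > 0"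
  define d where "d = e / (real (card F) + 1)"
  have "d > 0"
    using e by (simp add: d_def)
  then have "\<exists>x. x \<in> ball_on (A k) \<and> row_variation T i (A k) - d < norm (apply_bcontfun (blinfun_apply T x) i)" for k
    using row_variation_witness[of "row_variation T i (A k) - d" T i "A k"] by auto
  then obtain x where x: "\<And>k. x k \<in> ball_on (A k)"
      "\<And>k. row_variation T i (A k) - d < norm (apply_bcontfun (blinfun_apply T (x k)) i)"
    by metis
  have "(\<Sum>k\<in>F. row_variation T i (A k)) \<le> (\<Sum>k\<in>F. norm (apply_bcontfun (blinfun_apply T (x k)) i) + d)"
    using x(2) by (intro sum_mono) (simp add: less_imp_le diff_less_eq)
  also have "\<dots> = (\<Sum>k\<in>F. norm (apply_bcontfun (blinfun_apply T (x k)) i)) + real (card F) * d"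
    by (simp add: sum.distrib)
  also have "\<dots> \<le> norm T * real K + e"
  proof (rule add_mono)
    show "(\<Sum>k\<in>F. norm (apply_bcontfun (blinfun_apply T (x k)) i)) \<le> norm T * real K"
      using F x(1) overlap by (intro sum_row_norms_le[OF T] sum_ball_on_le)
    show "real (card F) * d \<le> e"
      using e by (simp add: d_def field_simps)
  qed
  finally show "(\<Sum>k\<in>F. row_variation T i (A k)) \<le> norm T * real K + e" .
qed

section \<open>Rows of a strictly singular operator\<close>

lemma subspace_closure:
  fixes S :: "'k::{real_normed_field,euclidean_space} linf set"
  assumes "linf.subspace S"
  shows "linf.subspace (closure S)"
proof (rule linf.subspaceI)
  show "0 \<in> closure S"
    using linf.subspace_0[OF assms] closure_subset by blast
next
  fix x y assume "x \<in> closure S" "y \<in> closure S"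
  then obtain f g where f: "\<And>n. f n \<in> S" "f \<longlonglongrightarrow> x" and g: "\<And>n. g n \<in> S" "g \<longlonglongrightarrow> y"
    by (auto simp: closure_sequential)
  then have "(\<lambda>n. f n + g n) \<longlonglongrightarrow> x + y"
    by (intro tendsto_add)
  then show "x + y \<in> closure S"
    unfolding closure_sequential
    by (intro exI[of _ "\<lambda>n. f n + g n"] conjI allI linf.subspace_add[OF assms] f(1) g(1))
next
  fix c :: 'k and x assume "x \<in> closure S"
  then obtain f where f: "\<And>n. f n \<in> S" "f \<longlonglongrightarrow> x"
    by (auto simp: closure_sequential)
  have "(\<lambda>n. norm c * norm (f n - x)) \<longlonglongrightarrow> norm c * 0"
    using f(2) by (intro tendsto_intros) (simp add: tendsto_norm_zero_iff LIM_zero_iff)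
  then have "(\<lambda>n. norm (scale_linf c (f n) - scale_linf c x)) \<longlonglongrightarrow> 0"
    by (simp flip: linf.scale_right_diff_distrib)
  then have "(\<lambda>n. scale_linf c (f n)) \<longlonglongrightarrow> scale_linf c x"
    by (simp add: tendsto_norm_zero_iff LIM_zero_iff)
  then show "scale_linf c x \<in> closure S"
    unfolding closure_sequential
    by (intro exI[of _ "\<lambda>n. scale_linf c (f n)"] conjI allI linf.subspace_scale[OF assms] f(1))
qed

text \<open>
  A lower bound on a subspace passes to its closure, and there it makes \<open>T\<close> a homeomorphism onto
  the image. Thus an explicitly described subspace of finite linear combinations can be used as a
  witness against strict singularity.
\<close>

lemma not_strictly_singular_if_bounded_below:
  fixes T :: "'k::{real_normed_field,euclidean_space} linf \<Rightarrow>\<^sub>L 'k linf"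
  assumes S: "linf.subspace S" and inf: "infinite X" "X \<subseteq> S" "linf.independent X"
    and c: "c > 0" and below: "\<And>y. y \<in> S \<Longrightarrow> c * norm y \<le> norm (blinfun_apply T y)"
  shows "\<not> strictly_singular T"
proof -
  define M where "M = closure S"
  have M: "linf.subspace M" "closed M"
    using subspace_closure[OF S] by (simp_all add: M_def)
  have "infinite_dimensional M"
    unfolding infinite_dimensional_def
  proof
    assume "\<exists>B. finite B \<and> linf.span B = M"
    then obtain B where B: "finite B" "linf.span B = M"
      by blast
    have "X \<subseteq> linf.span B"
      using inf(2) closure_subset B(2) unfolding M_def by blast
    then show False
      using linf.independent_span_bound[OF B(1) inf(3)] inf(1) by blast
  qed
  moreover have below_M: "c * norm y \<le> norm (blinfun_apply T y)" if y: "y \<in> M" for y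
  proof -
    obtain f where f: "\<And>n. f n \<in> S" "f \<longlonglongrightarrow> y"
      using y by (auto simp: M_def closure_sequential)
    have "(\<lambda>n. c * norm (f n)) \<longlonglongrightarrow> c * norm y"
      by (intro tendsto_intros f(2))
    moreover have "(\<lambda>n. norm (blinfun_apply T (f n))) \<longlonglongrightarrow> norm (blinfun_apply T y)"
      by (intro tendsto_intros f(2))
    ultimately show ?thesis
      by (rule LIMSEQ_le) (use below f(1) in blast)
  qed
  have dist: "c * dist x y \<le> dist (blinfun_apply T x) (blinfun_apply T y)" if "x \<in> M" "y \<in> M" for x y
    using below_M[OF linf.subspace_diff[OF M(1) that]] by (simp add: dist_norm blinfun.diff_right)
  have inj: "inj_on (blinfun_apply T) M"
  proof (rule inj_onI)
    fix x y assume "x \<in> M" "y \<in> M" "blinfun_apply T x = blinfun_apply T y"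
    then show "x = y"
      using dist[of x y] c by (simp add: mult_le_0_iff)
  qed
  have "homeomorphism M (blinfun_apply T ` M) (blinfun_apply T) (inv_into M (blinfun_apply T))"
  proof (rule homeomorphismI)
    show "continuous_on M (blinfun_apply T)"
      by (intro continuous_intros)
    show "continuous_on (blinfun_apply T ` M) (inv_into M (blinfun_apply T))"
    proof (rule continuous_on_iff[THEN iffD2], intro ballI allI impI)
      fix u e assume u: "u \<in> blinfun_apply T ` M" and e: "(0::real) < e"
      show "\<exists>d>0. \<forall>v\<in>blinfun_apply T ` M. dist v u < d \<longrightarrow>
          dist (inv_into M (blinfun_apply T) v) (inv_into M (blinfun_apply T) u) < e"
      proof (intro exI[of _ "c * e"] conjI ballI impI)
        fix v assume v: "v \<in> blinfun_apply T ` M" "dist v u < c * e"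
        have "c * dist (inv_into M (blinfun_apply T) v) (inv_into M (blinfun_apply T) u) \<le> dist v u"
          using dist[OF inv_into_into[OF v(1)] inv_into_into[OF u]] u v(1)
          by (simp add: f_inv_into_f)
        also note v(2)
        finally show "dist (inv_into M (blinfun_apply T) v) (inv_into M (blinfun_apply T) u) < e"
          using c by simp
      qed (use c e in simp)
    qed
  qed (use inj in \<open>auto simp: inv_into_f_f f_inv_into_f inv_into_into\<close>)
  ultimately show ?thesis
    unfolding strictly_singular_def using M by blast
qed

lemma sum_disjoint_ball_on_le_1:
  assumes "finite F" and "\<And>k. x k \<in> ball_on (A k)" and "disjoint_family A"
  shows "(\<Sum>k\<in>F. norm (apply_bcontfun (x k) t)) \<le> 1"
proof -
  have "card {k \<in> F. t \<in> A k} \<le> Suc 0"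
    using assms(1,3) by (subst card_le_Suc0_iff_eq) (auto simp: disjoint_family_on_def)
  then show ?thesis
    using sum_ball_on_le[of F x A t 1] assms(1,2) by simp
qed

text \<open>
  Otherwise there are vectors \<open>x n\<close>, supported by the disjoint sets \<open>A n\<close> and bounded by \<open>1\<close>, such
  that row \<open>i n\<close> is larger than \<open>c\<close> at \<open>x n\<close>. Rosenthal's matrix lemma gives an infinite set \<open>N\<close>
  of indices for which the off-diagonal entries \<open>T (x k) (i n)\<close> contribute at most \<open>c / 2\<close>. On the span of
  the \<open>x n\<close> with \<open>n \<in> N\<close>, a copy of the finitely supported sequences with the supremum norm up to
  constants, \<open>T\<close> is therefore bounded below: test the coordinate \<open>i n\<close> where \<open>n\<close> has the largest
  coefficient.
\<close>

lemma strictly_singular_exhaustive: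
  fixes T :: "'k::{real_normed_field,euclidean_space} linf \<Rightarrow>\<^sub>L 'k linf"
    and A :: "nat \<Rightarrow> nat set" and i :: "nat \<Rightarrow> nat"
  assumes T: "T \<in> linf_operators" and ss: "strictly_singular T"
    and A: "disjoint_family A" and c: "c > 0"
  shows "\<exists>n. row_variation T (i n) (A n) \<le> c"
proof (rule ccontr)
  assume "\<not> ?thesis"
  then have "\<exists>x. x \<in> ball_on (A n) \<and> c < norm (apply_bcontfun (blinfun_apply T x) (i n))" for n
    using row_variation_witness[of c T "i n" "A n"] by (metis not_le)
  then obtain x where x: "\<And>n. x n \<in> ball_on (A n)"
    and Tx: "\<And>n. c < norm (apply_bcontfun (blinfun_apply T (x n)) (i n))"
    by metis
  define a where "a n k = norm (apply_bcontfun (blinfun_apply T (x k)) (i n))" for n k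
  have "(\<Sum>k\<in>F. a n k) \<le> norm T * 1" if "finite F" for n F
    unfolding a_def
    by (intro sum_row_norms_le[OF T] sum_disjoint_ball_on_le_1[OF that _ A] x)
  then obtain N where N: "infinite N"
    and small: "\<And>n F. n \<in> N \<Longrightarrow> finite F \<Longrightarrow> F \<subseteq> N - {n} \<Longrightarrow> (\<Sum>k\<in>F. a n k) \<le> c / 2"
    using rosenthal_matrix_lemma[of a "norm T * 1" "c / 2"] c by (auto simp: a_def)
  have "\<exists>t. apply_bcontfun (x n) t \<noteq> 0" for n
  proof (rule ccontr)
    assume "\<not> ?thesis"
    then have "x n = 0"
      by (intro bcontfun_eqI) simp
    then show False
      using Tx[of n] c by simp
  qed
  then obtain t where t: "\<And>n. apply_bcontfun (x n) (t n) \<noteq> 0"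
    by metis
  have t_zero: "apply_bcontfun (x m) (t n) = 0" if "m \<noteq> n" for m n
  proof -
    have "t n \<in> A n"
      using t ball_on_zero[OF x] by blast
    then have "t n \<notin> A m"
      using A that by (auto simp: disjoint_family_on_def)
    then show ?thesis
      by (rule ball_on_zero[OF x])
  qed
  have inj: "inj x"
    using t t_zero by (metis injI)
  have indep: "linf.independent (x ` N)"
  proof
    assume "linf.dependent (x ` N)"
    then obtain n where n: "n \<in> N" "x n \<in> linf.span (x ` N - {x n})"
      by (auto simp: linf.dependent_def)
    have "linf.span (x ` N - {x n}) \<subseteq> {y. apply_bcontfun y (t n) = 0}"
    proof (rule linf.span_minimal)
      show "linf.subspace {y. apply_bcontfun y (t n) = 0}"
        by (rule linf.subspaceI) auto
    qed (auto simp: inj_eq[OF inj] t_zero)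
    then show False
      using n t by blast
  qed
  have span_form: "\<exists>F b. finite F \<and> F \<subseteq> N \<and> (\<forall>k. k \<notin> F \<longrightarrow> b k = 0) \<and> y = (\<Sum>k\<in>F. scale_linf (b k) (x k))"
    if "y \<in> linf.span (x ` N)" for y
    using that
  proof (induction rule: linf.span_induct_alt)
    case base
    then show ?case
      by (intro exI[of _ "{}"] exI[of _ "\<lambda>_. 0"]) simp
  next
    case (step d u y)
    then obtain n F b where nF: "n \<in> N" "u = x n" "finite F" "F \<subseteq> N" "\<forall>k. k \<notin> F \<longrightarrow> b k = 0"
      "y = (\<Sum>k\<in>F. scale_linf (b k) (x k))"
      by auto
    have "y = (\<Sum>k\<in>insert n F. scale_linf (b k) (x k))"
      using nF by (cases "n \<in> F") (auto simp: insert_absorb)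
    also have "scale_linf d u + \<dots> = (\<Sum>k\<in>insert n F. scale_linf ((b(n := d + b n)) k) (x k))"
      using nF(2,3)
      by (simp add: sum.insert_remove linf.scale_left_distrib add.assoc)
    finally show ?case
      using nF by (intro exI[of _ "insert n F"] exI[of _ "b(n := d + b n)"]) auto
  qed
  have "c / 2 * norm y \<le> norm (blinfun_apply T y)" if y: "y \<in> linf.span (x ` N)" for y
  proof -
    obtain F b where F: "finite F" "F \<subseteq> N" and y_eq: "y = (\<Sum>k\<in>F. scale_linf (b k) (x k))"
      using span_form[OF y] by blast
    show ?thesis
    proof (cases "F = {}")
      case False
      then obtain n where n: "n \<in> F" "\<And>k. k \<in> F \<Longrightarrow> norm (b k) \<le> norm (b n)"
        using obtains_MAX[OF F(1) False, of "\<lambda>k. norm (b k)"] F(1) by (metis Max_ge finite_imageI imageI)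
      have "norm y \<le> norm (b n)"
      proof (rule norm_bound)
        fix s
        have "norm (apply_bcontfun y s) \<le> (\<Sum>k\<in>F. norm (b n) * norm (apply_bcontfun (x k) s))"
          unfolding y_eq apply_bcontfun_sum
          by (rule sum_norm_le) (simp add: norm_mult mult_right_mono n(2))
        also have "\<dots> \<le> norm (b n) * 1"
          unfolding sum_distrib_left[symmetric]
          by (intro mult_left_mono sum_disjoint_ball_on_le_1[OF F(1) x A]) simp
        finally show "norm (apply_bcontfun y s) \<le> norm (b n)"
          by simp
      qed
      have "apply_bcontfun (blinfun_apply T y) (i n) =
          (\<Sum>k\<in>F. b k * apply_bcontfun (blinfun_apply T (x k)) (i n))"
        by (simp add: y_eq blinfun.sum_right apply_bcontfun_sum operator_scale[OF T])
      also have "\<dots> = b n * apply_bcontfun (blinfun_apply T (x n)) (i n) +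
          (\<Sum>k\<in>F - {n}. b k * apply_bcontfun (blinfun_apply T (x k)) (i n))"
        by (rule sum.remove[OF F(1) n(1)])
      finally have eq: "b n * apply_bcontfun (blinfun_apply T (x n)) (i n) =
          apply_bcontfun (blinfun_apply T y) (i n) -
          (\<Sum>k\<in>F - {n}. b k * apply_bcontfun (blinfun_apply T (x k)) (i n))"
        by simp
      have "norm (\<Sum>k\<in>F - {n}. b k * apply_bcontfun (blinfun_apply T (x k)) (i n))
          \<le> (\<Sum>k\<in>F - {n}. norm (b n) * a n k)"
        by (rule sum_norm_le) (simp add: norm_mult a_def mult_right_mono n(2))
      also have "\<dots> \<le> norm (b n) * (c / 2)"
        unfolding sum_distrib_left[symmetric] using F n(1) by (intro mult_left_mono small) auto
      finally have off: "norm (\<Sum>k\<in>F - {n}. b k * apply_bcontfun (blinfun_apply T (x k)) (i n))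
          \<le> norm (b n) * (c / 2)" .
      have "norm (b n) * c \<le> norm (b n * apply_bcontfun (blinfun_apply T (x n)) (i n))"
        using Tx[of n] by (simp add: norm_mult mult_left_mono)
      also have "\<dots> \<le> norm (blinfun_apply T y) + norm (b n) * (c / 2)"
        unfolding eq by (intro order_trans[OF norm_triangle_ineq4] add_mono off norm_coord_le)
      finally have "norm (b n) * (c / 2) \<le> norm (blinfun_apply T y)"
        by simp
      moreover have "c / 2 * norm y \<le> c / 2 * norm (b n)"
        using \<open>norm y \<le> norm (b n)\<close> c by (intro mult_left_mono) auto
      ultimately show ?thesis
        by (simp add: mult.commute)
    qed (simp add: y_eq)
  qed
  moreover have "infinite (x ` N)"
    using N inj by (simp add: finite_image_iff inj_on_subset)
  moreover have "c / 2 > 0"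
    using c by simp
  ultimately have "\<not> strictly_singular T"
    by (intro not_strictly_singular_if_bounded_below[OF linf.subspace_span _ linf.span_superset indep])
  then show False
    using ss by simp
qed

text \<open>
  If the increments of \<open>U\<close> did not become uniformly small, successive increments would form a
  disjoint sequence that contradicts the previous lemma.
\<close>

lemma strictly_singular_increasing_union:
  fixes T :: "'k::{real_normed_field,euclidean_space} linf \<Rightarrow>\<^sub>L 'k linf"
    and U :: "nat \<Rightarrow> nat set"
  assumes T: "T \<in> linf_operators" and ss: "strictly_singular T"
    and U: "incseq U" and c: "c > 0"
  shows "\<exists>p. \<forall>q i. row_variation T i (U q - U p) \<le> c"
proof (rule ccontr)
  assume "\<not> ?thesis"
  then have "\<forall>p. \<exists>q i. c < row_variation T i (U q - U p)"
    by (meson not_le)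
  then obtain next_p row where np: "\<And>p. c < row_variation T (row p) (U (next_p p) - U p)"
    by metis
  have mono_np: "p \<le> next_p p" for p
  proof (rule ccontr)
    assume "\<not> p \<le> next_p p"
    then have empty: "U (next_p p) - U p = {}"
      using incseqD[OF U, of "next_p p" p] by auto
    show False
      using np[of p] c unfolding empty by simp
  qed
  define p where "p n = (next_p ^^ n) 0" for n
  define D where "D n = U (p (Suc n)) - U (p n)" for n
  have "incseq p"
    by (rule incseq_SucI) (simp add: p_def mono_np)
  then have mono: "U (p m) \<subseteq> U (p n)" if "m \<le> n" for m n
    using that by (intro incseqD[OF U]) (simp add: incseqD)
  have "disjoint_family D"
    unfolding disjoint_family_on_def
  proof (intro ballI impI)
    fix m n :: nat assume "m \<noteq> n"
    then show "D m \<inter> D n = {}"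
      using mono[of "Suc m" n] mono[of "Suc n" m] by (cases m n rule: linorder_cases) (auto simp: D_def)
  qed
  then obtain n where "row_variation T (row (p n)) (D n) \<le> c"
    using strictly_singular_exhaustive[OF T ss _ c, of D "\<lambda>n. row (p n)"] by blast
  then show False
    using np[of "p n"] by (simp add: D_def p_def)
qed

lemma geometric_sum_le:
  fixes F :: "nat set"
  assumes "finite F"
  shows "(\<Sum>k\<in>F. (1/2::real) ^ Suc k) \<le> 1"
proof -
  have "(\<Sum>k\<in>F. (1/2::real) ^ Suc k) \<le> (\<Sum>k. (1/2) ^ Suc k)"
    using power_half_series assms by (intro sum_le_suminf) (auto simp: sums_iff)
  then show ?thesis
    using power_half_series by (simp add: sums_iff)
qed

text \<open>
  Finitely many rows control the variation of all the others, a form of the theorem of Bartle,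
  Dunford and Schwartz on control measures. If this fails, there are sets \<open>A n\<close> and rows \<open>i n\<close>, where
  row \<open>i n\<close> has variation larger than \<open>e\<close> on \<open>A n\<close> and the earlier rows have very small variation on
  \<open>A n\<close>. To make the sets disjoint one would remove from \<open>A n\<close> all later sets, but finite additivity
  gives no bound for the variation on an infinite union. Since increasing unions stabilise, the finite union
  \<open>V n\<close> of the sets up to a certain index \<open>p n\<close> exhausts the later sets up to variation \<open>d n\<close>, for
  all rows at once. Removing \<open>V n\<close> from \<open>A n\<close>, and then the trimmed earlier sets, costs at most
  \<open>e / 4\<close> of the variation.
\<close>

lemma strictly_singular_control:
  fixes T :: "'k::{real_normed_field,euclidean_space} linf \<Rightarrow>\<^sub>L 'k linf"
  assumes T: "T \<in> linf_operators" and ss: "strictly_singular T" and e: "e > 0"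
  obtains F d where "finite F" "d > 0"
    and "\<And>A i. (\<And>j. j \<in> F \<Longrightarrow> row_variation T j A < d) \<Longrightarrow> row_variation T i A \<le> e"
proof (rule ccontr)
  note control = that
  assume neg: "\<not> thesis"
  have ex: "\<exists>A i. (\<forall>j\<in>F. row_variation T j A < d) \<and> e < row_variation T i A"
    if Fd: "finite F" "d > 0" for F d
  proof (rule ccontr)
    assume "\<not> ?thesis"
    then have "row_variation T i A \<le> e" if "\<And>j. j \<in> F \<Longrightarrow> row_variation T j A < d" for A i
      using that by (metis not_less)
    then have thesis
      by (rule control[OF Fd])
    then show False
      using neg by simp
  qed
  define d where "d n = e / 8 * (1/2) ^ Suc n" for n :: nat
  have d: "d n > 0" for n
    using e by (simp add: d_def)
  have d_sum: "(\<Sum>n\<in>F. d n) \<le> e / 8" if "finite F" for F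
    using mult_left_mono[OF geometric_sum_le[OF that], of "e / 8"] e
    by (simp only: d_def flip: sum_distrib_left) simp
  have "\<exists>A i. finite F \<longrightarrow> (\<forall>j\<in>F. row_variation T j A < d n) \<and> e < row_variation T i A" for F n
    using ex[OF _ d[of n], of F] by blast
  then obtain new_set new_row where pick: "finite F \<Longrightarrow>
      (\<forall>j\<in>F. row_variation T j (new_set F n) < d n) \<and> e < row_variation T (new_row F n) (new_set F n)"
    for F n
    by metis
  define rows where "rows = rec_nat {} (\<lambda>n F. insert (new_row F n) F)"
  have rows_simps: "rows 0 = {}" "rows (Suc n) = insert (new_row (rows n) n) (rows n)" for n
    by (simp_all add: rows_def)
  have fin: "finite (rows n)" for n
    by (induction n) (simp_all add: rows_simps)
  define A where "A n = new_set (rows n) n" for n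
  define i where "i n = new_row (rows n) n" for n
  have big: "e < row_variation T (i n) (A n)" for n
    using pick[OF fin] by (simp add: A_def i_def)
  have i_rows: "i m \<in> rows n" if "m < n" for m n
    using that by (induction n) (auto simp: rows_simps i_def less_Suc_eq)
  have small: "row_variation T (i m) (A n) < d n" if "m < n" for m n
    using pick[OF fin, of n n] i_rows[OF that] by (simp add: A_def)
  have "\<exists>p. \<forall>q i. row_variation T i ((\<Union>k\<in>{n<..q}. A k) - (\<Union>k\<in>{n<..p}. A k)) \<le> d n" for n
    by (rule strictly_singular_increasing_union[OF T ss _ d]) (force simp: incseq_def)
  then obtain p where p: "\<And>n q i. row_variation T i ((\<Union>k\<in>{n<..q}. A k) - (\<Union>k\<in>{n<..p n}. A k)) \<le> d n"
    by metis
  define V where "V n = (\<Union>k\<in>{n<..p n}. A k)" for n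
  define D where "D n = A n - V n - (\<Union>m<n. A m - V m)" for n
  have D_disj: "D m \<inter> D n = {}" if "m < n" for m n
    using that by (auto simp: D_def)
  have "disjoint_family D"
    unfolding disjoint_family_on_def
  proof (intro ballI impI)
    fix m n :: nat assume "m \<noteq> n"
    then show "D m \<inter> D n = {}"
      using D_disj[of m n] D_disj[of n m] by (cases m n rule: linorder_cases) auto
  qed
  then obtain n where n: "row_variation T (i n) (D n) \<le> e / 2"
    using strictly_singular_exhaustive[OF T ss, of D "e / 2" i] e by auto
  have "row_variation T (i n) (V n) \<le> (\<Sum>k\<in>{n<..p n}. d k)"
    unfolding V_def
    by (rule order_trans[OF row_variation_UN sum_mono]) (auto intro: less_imp_le small)
  then have V: "row_variation T (i n) (V n) \<le> e / 8"
    using d_sum[of "{n<..p n}"] by simp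
  have "row_variation T (i n) (A n - V m) \<le> d m" if "m < n" for m
    by (rule order_trans[OF row_variation_mono p[of "i n" m n]]) (use that in \<open>auto simp: V_def\<close>)
  then have "row_variation T (i n) (\<Union>m<n. A n - V m) \<le> (\<Sum>m<n. d m)"
    by (intro order_trans[OF row_variation_UN sum_mono]) auto
  then have P: "row_variation T (i n) (\<Union>m<n. A n - V m) \<le> e / 8"
    using d_sum[of "{..<n}"] by simp
  have "A n \<subseteq> D n \<union> (V n \<union> (\<Union>m<n. A n - V m))"
    by (auto simp: D_def)
  then have "row_variation T (i n) (A n) \<le>
      row_variation T (i n) (D n) + row_variation T (i n) (V n \<union> (\<Union>m<n. A n - V m))"
    by (rule row_variation_subadditive)
  also have "row_variation T (i n) (V n \<union> (\<Union>m<n. A n - V m)) \<le>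
      row_variation T (i n) (V n) + row_variation T (i n) (\<Union>m<n. A n - V m)"
    by (rule row_variation_subadditive) simp
  finally show False
    using n V P big[of n] e by simp
qed

section \<open>Small signed averages of rows\<close>

lemma card_large_coordinates_le:
  fixes u :: "'i \<Rightarrow> 'a::real_normed_vector"
  assumes B: "finite B" and sq: "(\<Sum>i\<in>B. (norm (u i))\<^sup>2) \<le> 1"
    and h: "h > 0" and K: "1 / h\<^sup>2 \<le> real K"
  shows "card {i \<in> B. h < norm (u i)} \<le> K"
proof -
  have "real (card {i \<in> B. h < norm (u i)}) * h\<^sup>2 = (\<Sum>i\<in>{i \<in> B. h < norm (u i)}. h\<^sup>2)"
    by simp
  also have "\<dots> \<le> (\<Sum>i\<in>{i \<in> B. h < norm (u i)}. (norm (u i))\<^sup>2)"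
    using h by (intro sum_mono power_mono) auto
  also have "\<dots> \<le> (\<Sum>i\<in>B. (norm (u i))\<^sup>2)"
    using B by (intro sum_mono2) auto
  also have "\<dots> \<le> 1"
    by (rule sq)
  finally have "real (card {i \<in> B. h < norm (u i)}) \<le> 1 / h\<^sup>2"
    using h by (simp add: field_simps)
  then show ?thesis
    using K by linarith
qed

text \<open>
  Choose for each sign pattern \<open>S\<close> a vector \<open>X S\<close> of the unit ball at which the signed sum of rows is
  at least \<open>e\<close>, and let \<open>g i\<close> be the \<open>i\<close>-th Rademacher coefficient of \<open>X\<close>. Bessel's inequality at
  each coordinate bounds the square function of the \<open>g i\<close>, and averaging over the patterns moves the
  signs from the rows to the vectors.
\<close>

lemma signed_rows_square_function:
  fixes T :: "'k::{real_normed_field,euclidean_space} linf \<Rightarrow>\<^sub>L 'k linf"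
  assumes T: "T \<in> linf_operators" and B: "finite B"
    and large: "\<And>S. \<exists>x. e * norm x < norm (\<Sum>i\<in>B. of_real (sign_of S i) * apply_bcontfun (blinfun_apply T x) i)"
  obtains g where "\<And>t. (\<Sum>i\<in>B. (norm (apply_bcontfun (g i) t))\<^sup>2) \<le> 1"
    and "e \<le> (\<Sum>i\<in>B. norm (apply_bcontfun (blinfun_apply T (g i)) i))"
proof -
  define f where "f S x = (\<Sum>i\<in>B. of_real (sign_of S i) * apply_bcontfun (blinfun_apply T x) i)" for S x
  have f_scale: "f S (scale_linf c x) = c * f S x" for S c x
    by (simp add: f_def operator_scale[OF T] sum_distrib_left mult.left_commute)
  have "\<exists>x r. norm x \<le> 1 \<and> f S x = of_real r \<and> e \<le> r" for S
  proof -
    obtain x where x: "e * norm x < norm (f S x)"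
      using large unfolding f_def by blast
    have x0: "x \<noteq> 0"
    proof
      assume "x = 0"
      then show False
        using x by (simp add: f_def)
    qed
    obtain \<theta> where \<theta>: "norm \<theta> = 1" "\<theta> * f S x = of_real (norm (f S x))"
      by (rule rotate_to_norm)
    let ?y = "scale_linf (\<theta> / of_real (norm x)) x"
    have "norm ?y \<le> 1"
      using \<theta>(1) x0 by (simp add: norm_divide)
    moreover have "f S ?y = of_real (norm (f S x) / norm x)"
      using \<theta>(2) by (simp add: f_scale)
    moreover have "e \<le> norm (f S x) / norm x"
      using x x0 by (simp add: field_simps)
    ultimately show ?thesis
      by blast
  qed
  then obtain X r where X: "\<And>S. norm (X S) \<le> 1" "\<And>S. f S (X S) = of_real (r S)" "\<And>S. e \<le> r S"
    by metis
  define p :: real where "p = 2 ^ card B"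
  have p: "p > 0" "real (card (Pow B)) = p"
    using B by (simp_all add: p_def card_Pow)
  define g where "g i = (1 / p) *\<^sub>R (\<Sum>S\<in>Pow B. sign_of S i *\<^sub>R X S)" for i
  have g_app: "apply_bcontfun (g i) t = (1 / p) *\<^sub>R (\<Sum>S\<in>Pow B. sign_of S i *\<^sub>R apply_bcontfun (X S) t)" for i t
    by (simp add: g_def apply_bcontfun_sum)
  show ?thesis
  proof (rule that[of g])
    fix t
    have "(\<Sum>S\<in>Pow B. (norm (apply_bcontfun (X S) t))\<^sup>2) \<le> (\<Sum>S\<in>Pow B. 1)"
      by (intro sum_mono power_le_one order_trans[OF norm_coord_le X(1)]) simp
    then have le: "(\<Sum>S\<in>Pow B. (norm (apply_bcontfun (X S) t))\<^sup>2) \<le> p"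
      using p(2) by simp
    have "(\<Sum>i\<in>B. (norm (apply_bcontfun (g i) t))\<^sup>2) =
        (1 / p)\<^sup>2 * (\<Sum>i\<in>B. (norm (\<Sum>S\<in>Pow B. sign_of S i *\<^sub>R apply_bcontfun (X S) t))\<^sup>2)"
      by (simp add: g_app power_mult_distrib power_divide sum_distrib_left)
    also have "\<dots> \<le> (1 / p)\<^sup>2 * (p * p)"
      using le p(1)
      by (intro mult_left_mono order_trans[OF bessel_rademacher[OF B]]) (auto simp: p_def)
    also have "\<dots> = 1"
      using p(1) by (simp add: power2_eq_square)
    finally show "(\<Sum>i\<in>B. (norm (apply_bcontfun (g i) t))\<^sup>2) \<le> 1" .
  next
    have "(\<Sum>i\<in>B. apply_bcontfun (blinfun_apply T (g i)) i) =
        (1 / p) *\<^sub>R (\<Sum>i\<in>B. \<Sum>S\<in>Pow B. sign_of S i *\<^sub>R apply_bcontfun (blinfun_apply T (X S)) i)"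
      by (simp add: g_def blinfun.scaleR_right blinfun.sum_right apply_bcontfun_sum scaleR_sum_right)
    also have "\<dots> = (1 / p) *\<^sub>R (\<Sum>S\<in>Pow B. f S (X S))"
      by (subst sum.swap) (simp add: f_def scaleR_conv_of_real)
    also have "\<dots> = of_real ((1 / p) * (\<Sum>S\<in>Pow B. r S))"
      by (simp add: X(2) scaleR_conv_of_real)
    finally have eq: "(\<Sum>i\<in>B. apply_bcontfun (blinfun_apply T (g i)) i) =
        of_real ((1 / p) * (\<Sum>S\<in>Pow B. r S))" .
    have "(\<Sum>S\<in>Pow B. e) \<le> (\<Sum>S\<in>Pow B. r S)"
      by (intro sum_mono X(3))
    then have "p * e \<le> (\<Sum>S\<in>Pow B. r S)"
      using p(2) by simp
    then have "e \<le> (1 / p) * (\<Sum>S\<in>Pow B. r S)"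
      using p(1) by (simp add: field_simps)
    also have "\<dots> \<le> norm (\<Sum>i\<in>B. apply_bcontfun (blinfun_apply T (g i)) i)"
      unfolding eq norm_of_real by (rule abs_ge_self)
    also have "\<dots> \<le> (\<Sum>i\<in>B. norm (apply_bcontfun (blinfun_apply T (g i)) i))"
      by (rule norm_sum)
    finally show "e \<le> (\<Sum>i\<in>B. norm (apply_bcontfun (blinfun_apply T (g i)) i))" .
  qed
qed

text \<open>
  If all signed averages of \<open>n\<close> rows were larger than \<open>e\<close>, the preceding lemma would give vectors
  \<open>g i\<close> with square function at most \<open>1\<close> on which the rows sum up to at least \<open>e n\<close>. The part of \<open>g i\<close>
  below the level \<open>h\<close> contributes at most \<open>e / 2\<close> per row. The rest lives on the set \<open>A i\<close> where
  \<open>g i\<close> exceeds \<open>h\<close>, and the bound on the square function makes the sets \<open>A i\<close> overlap at most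
  \<open>1 / h\<^sup>2\<close> times. Finitely many rows control the variation of every row, and the total variation of
  each of these on sets of bounded overlap is bounded. Hence the sum of the variations of row \<open>i\<close>
  on \<open>A i\<close> is at most \<open>e n / 4\<close> plus a number that does not depend on \<open>n\<close>, which is absurd for
  large \<open>n\<close>. The averages may start at an arbitrary row \<open>m\<close>, which allows disjoint blocks later.
\<close>

lemma small_signed_average:
  fixes T :: "'k::{real_normed_field,euclidean_space} linf \<Rightarrow>\<^sub>L 'k linf"
  assumes T: "T \<in> linf_operators" and ss: "strictly_singular T" and e: "e > 0"
  obtains n S where "n > 0" and "\<And>x. norm (\<Sum>i\<in>{m..<m + n}. of_real (sign_of S i) * apply_bcontfun (blinfun_apply T x) i)
      \<le> e * real n * norm x"
proof (rule ccontr)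
  note avg = that
  assume neg: "\<not> thesis"
  obtain F d where F: "finite F" and d: "d > 0"
    and control: "\<And>A i. (\<And>j. j \<in> F \<Longrightarrow> row_variation T j A < d) \<Longrightarrow> row_variation T i A \<le> e / 4"
    by (rule strictly_singular_control[OF T ss, of "e / 4"]) (use e in auto)
  define C where "C = norm T + 1"
  have C: "C > 0" "norm T \<le> C"
    by (simp_all add: C_def add_nonneg_pos)
  define h where "h = e / (2 * C)"
  have h: "h > 0"
    using e C by (simp add: h_def)
  obtain K :: nat where K: "1 / h\<^sup>2 \<le> real K"
    using real_arch_simple by blast
  \<comment> \<open>The control in a form that can be summed over \<open>i\<close>.\<close>
  have dominate: "row_variation T i A \<le> e / 4 + C / d * (\<Sum>j\<in>F. row_variation T j A)" for i A
  proof (cases "\<forall>j\<in>F. row_variation T j A < d")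
    case True
    moreover have "0 \<le> C / d * (\<Sum>j\<in>F. row_variation T j A)"
      using C d by (intro mult_nonneg_nonneg sum_nonneg row_variation_nonneg) auto
    ultimately show ?thesis
      using control[of A i] by fastforce
  next
    case False
    then obtain j where j: "j \<in> F" "d \<le> row_variation T j A"
      by (auto simp: not_less)
    then have "d \<le> (\<Sum>j\<in>F. row_variation T j A)"
      using member_le_sum[OF j(1), of "\<lambda>j. row_variation T j A"] F row_variation_nonneg
      by (smt (verit))
    then have "C / d * d \<le> C / d * (\<Sum>j\<in>F. row_variation T j A)"
      using C d by (intro mult_left_mono) auto
    then have "C \<le> C / d * (\<Sum>j\<in>F. row_variation T j A)"
      using d by simp
    then show ?thesis
      using row_variation_le_norm[of T i A] C(2) e by linarith
  qed
  define D where "D = C / d * (real (card F) * (C * real K))"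
  obtain n :: nat where n: "D < real n * (e / 4)"
    using reals_Archimedean3[of "e / 4"] e by (auto simp: mult.commute)
  have D0: "D \<ge> 0"
    using C d by (simp add: D_def)
  then have n0: "n > 0"
    using n by (cases n) auto
  define B where "B = {m..<m + n}"
  have B: "finite B" "card B = n"
    by (simp_all add: B_def)
  have "\<exists>x. e * real n * norm x < norm (\<Sum>i\<in>B. of_real (sign_of S i) * apply_bcontfun (blinfun_apply T x) i)" for S
    using avg[OF n0, of S] neg unfolding B_def by (meson not_le)
  then obtain g where sq: "\<And>t. (\<Sum>i\<in>B. (norm (apply_bcontfun (g i) t))\<^sup>2) \<le> 1"
    and Tg: "e * real n \<le> (\<Sum>i\<in>B. norm (apply_bcontfun (blinfun_apply T (g i)) i))"
    using signed_rows_square_function[OF T B(1), of "e * real n"] by auto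
  define A where "A i = {t. h < norm (apply_bcontfun (g i) t)}" for i
  have overlap: "card {i \<in> B. t \<in> A i} \<le> K" for t
    using card_large_coordinates_le[OF B(1) sq h K] by (simp add: A_def)
  have row: "norm (apply_bcontfun (blinfun_apply T (g i)) i) \<le> row_variation T i (A i) + e / 2"
    if i: "i \<in> B" for i
  proof -
    have le: "norm (apply_bcontfun (g i) t) \<le> 1" for t
    proof -
      have "(norm (apply_bcontfun (g i) t))\<^sup>2 \<le> 1"
        using member_le_sum[OF i, of "\<lambda>i. (norm (apply_bcontfun (g i) t))\<^sup>2"] B(1) sq[of t] by simp
      then show ?thesis
        by (simp add: power_le_one_iff abs_square_le_1)
    qed
    have split: "g i = restrict_linf (A i) (g i) + restrict_linf (- A i) (g i)"
      by (rule bcontfun_eqI) simp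
    have "restrict_linf (A i) (g i) \<in> ball_on (A i)"
      using le by (simp add: ball_on_def)
    then have 1: "norm (apply_bcontfun (blinfun_apply T (restrict_linf (A i) (g i))) i) \<le> row_variation T i (A i)"
      by (rule row_le_variation)
    have "norm (restrict_linf (- A i) (g i)) \<le> h"
      by (rule norm_bound) (use h in \<open>auto simp: A_def\<close>)
    then have "norm (apply_bcontfun (blinfun_apply T (restrict_linf (- A i) (g i))) i) \<le> C * h"
      using C by (intro order_trans[OF norm_operator_coord_le] mult_mono) auto
    then have 2: "norm (apply_bcontfun (blinfun_apply T (restrict_linf (- A i) (g i))) i) \<le> e / 2"
      using C by (simp add: h_def)
    have "apply_bcontfun (blinfun_apply T (g i)) i =
        apply_bcontfun (blinfun_apply T (restrict_linf (A i) (g i))) i +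
        apply_bcontfun (blinfun_apply T (restrict_linf (- A i) (g i))) i"
      by (subst split) (simp only: blinfun.add_right plus_bcontfun.rep_eq)
    then show ?thesis
      using norm_triangle_ineq 1 2 by (smt (verit))
  qed
  have "e * real n \<le> (\<Sum>i\<in>B. row_variation T i (A i) + e / 2)"
    using Tg row by (meson order_trans sum_mono)
  also have "\<dots> \<le> (\<Sum>i\<in>B. 3 * e / 4 + C / d * (\<Sum>j\<in>F. row_variation T j (A i)))"
  proof (rule sum_mono)
    fix i
    show "row_variation T i (A i) + e / 2 \<le> 3 * e / 4 + C / d * (\<Sum>j\<in>F. row_variation T j (A i))"
      using dominate[of i "A i"] by linarith
  qed
  also have "\<dots> = real n * (3 * e / 4) + C / d * (\<Sum>i\<in>B. \<Sum>j\<in>F. row_variation T j (A i))"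
    by (simp add: sum.distrib sum_distrib_left B(2))
  also have "(\<Sum>i\<in>B. \<Sum>j\<in>F. row_variation T j (A i)) = (\<Sum>j\<in>F. \<Sum>i\<in>B. row_variation T j (A i))"
    by (rule sum.swap)
  also have "C / d * (\<Sum>j\<in>F. \<Sum>i\<in>B. row_variation T j (A i)) \<le> D"
  proof -
    have "(\<Sum>i\<in>B. row_variation T j (A i)) \<le> C * real K" for j
      using sum_row_variation_le[OF T B(1) overlap, of j] C(2)
      by (meson mult_right_mono of_nat_0_le_iff order_trans)
    then have "(\<Sum>j\<in>F. \<Sum>i\<in>B. row_variation T j (A i)) \<le> (\<Sum>j\<in>F. C * real K)"
      by (intro sum_mono)
    then show ?thesis
      using C d unfolding D_def by (intro mult_left_mono) auto
  qed
  finally show False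
    using n by (simp add: algebra_simps)
qed

section \<open>Strictly singular operators are commutators\<close>

text \<open>
  The operator \<open>V\<close> takes signed averages over consecutive disjoint blocks of coordinates, chosen such that the
  \<open>m\<close>-th average composed with \<open>T\<close> has norm at most \<open>d m\<close>; \<open>J\<close> spreads the \<open>m\<close>-th coordinate over the
  \<open>m\<close>-th block with the same signs and vanishes outside the blocks.
\<close>

lemma strictly_singular_quotient_rows:
  fixes T :: "'k::{real_normed_field,euclidean_space} linf \<Rightarrow>\<^sub>L 'k linf" and d :: "nat \<Rightarrow> real"
  assumes T: "T \<in> linf_operators" and ss: "strictly_singular T" and d: "\<And>m. d m > 0"
  obtains V J where "V \<in> linf_operators" "J \<in> linf_operators" "V o\<^sub>L J = id_blinfun"
    and "\<And>x m. norm (apply_bcontfun (blinfun_apply V (blinfun_apply T x)) m) \<le> d m * norm x"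
proof -
  define small_block where "small_block m a n S \<longleftrightarrow> n > 0 \<and>
      (\<forall>x. norm (\<Sum>i\<in>{a..<a + n}. of_real (sign_of S i) * apply_bcontfun (blinfun_apply T x) i)
        \<le> d m * real n * norm x)" for m a n S
  have "\<exists>n S. small_block m a n S" for m a
    by (rule small_signed_average[OF T ss d[of m], of a]) (auto simp: small_block_def)
  then obtain len pat where block: "\<And>m a. small_block m a (len m a) (pat m a)"
    by metis
  then have len: "len m a > 0" and small: "norm (\<Sum>i\<in>{a..<a + len m a}.
      of_real (sign_of (pat m a) i) * apply_bcontfun (blinfun_apply T x) i)
      \<le> d m * real (len m a) * norm x" for m a x
    by (simp_all add: small_block_def)
  define start where "start = rec_nat 0 (\<lambda>m a. a + len m a)"
  define n where "n m = len m (start m)" for m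
  define s :: "nat \<Rightarrow> nat \<Rightarrow> 'k" where "s m i = of_real (sign_of (pat m (start m)) i)" for m i
  define B where "B m = {start m..<start m + n m}" for m
  have start: "start (Suc m) = start m + n m" for m
    by (simp add: start_def n_def)
  have n: "n m > 0" for m
    by (simp add: n_def len)
  have mono: "start m + n m \<le> start k" if "m < k" for m k
    using that by (induction k) (auto simp: start less_Suc_eq)
  have disj: "m = k" if "i \<in> B m" "i \<in> B k" for i m k
    using that mono[of m k] mono[of k m] by (cases m k rule: linorder_cases) (auto simp: B_def)
  have s: "norm (s m i) = 1" "s m i * s m i = 1" for m i
    using sign_of_cases[of "pat m (start m)" i] by (auto simp: s_def)
  obtain V :: "'k linf \<Rightarrow>\<^sub>L 'k linf" where V: "V \<in> linf_operators"
    and V_app: "\<And>x m. apply_bcontfun (V x) m = (\<Sum>i\<in>B m. s m i * apply_bcontfun x i) / of_nat (n m)"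
  proof (rule operator_from_coordinates[of "\<lambda>x m. (\<Sum>i\<in>B m. s m i * apply_bcontfun x i) / of_nat (n m)" 1])
    fix x y :: "'k linf" and c m
    show "(\<Sum>i\<in>B m. s m i * apply_bcontfun (x + y) i) / of_nat (n m) =
        (\<Sum>i\<in>B m. s m i * apply_bcontfun x i) / of_nat (n m) +
        (\<Sum>i\<in>B m. s m i * apply_bcontfun y i) / of_nat (n m)"
      by (simp add: distrib_left sum.distrib add_divide_distrib)
    show "(\<Sum>i\<in>B m. s m i * apply_bcontfun (scale_linf c x) i) / of_nat (n m) =
        c * ((\<Sum>i\<in>B m. s m i * apply_bcontfun x i) / of_nat (n m))"
      by (simp add: sum_distrib_left mult.left_commute)
    have "norm (\<Sum>i\<in>B m. s m i * apply_bcontfun x i) \<le> (\<Sum>i\<in>B m. norm x)"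
      by (rule sum_norm_le) (simp add: norm_mult s norm_coord_le)
    then show "norm ((\<Sum>i\<in>B m. s m i * apply_bcontfun x i) / of_nat (n m)) \<le> 1 * norm x"
      using n[of m] by (simp add: norm_divide B_def field_simps)
  qed blast
  obtain J :: "'k linf \<Rightarrow>\<^sub>L 'k linf" where J: "J \<in> linf_operators"
    and J_app: "\<And>y i. apply_bcontfun (J y) i =
      (if \<exists>m. i \<in> B m then s (THE m. i \<in> B m) i * apply_bcontfun y (THE m. i \<in> B m) else 0)"
    by (rule operator_from_coordinates[of "\<lambda>y i. if \<exists>m. i \<in> B m
        then s (THE m. i \<in> B m) i * apply_bcontfun y (THE m. i \<in> B m) else 0" 1])
      (auto simp: distrib_left norm_mult s norm_coord_le)
  have J_B: "apply_bcontfun (J y) i = s m i * apply_bcontfun y m" if "i \<in> B m" for y i m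
  proof -
    have "(THE m. i \<in> B m) = m"
      using that disj by blast
    then show ?thesis
      using that by (auto simp: J_app)
  qed
  have "V (J y) = y" for y
  proof (rule bcontfun_eqI)
    fix m
    have "(\<Sum>i\<in>B m. s m i * apply_bcontfun (J y) i) = (\<Sum>i\<in>B m. apply_bcontfun y m)"
      by (intro sum.cong) (simp_all add: J_B s flip: mult.assoc)
    then show "apply_bcontfun (V (J y)) m = apply_bcontfun y m"
      using n[of m] by (simp add: V_app B_def)
  qed
  then have "V o\<^sub>L J = id_blinfun"
    by (intro blinfun_eqI) simp
  moreover have "norm (apply_bcontfun (V (blinfun_apply T x)) m) \<le> d m * norm x" for x m
    using small[where a = "start m" and m = m and x = x] n[of m]
    by (simp add: V_app norm_divide B_def s_def field_simps flip: n_def)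
  ultimately show ?thesis
    using that V J by blast
qed

theorem theorem5p5:
  fixes T :: "'k::{real_normed_field,euclidean_space} linf \<Rightarrow>\<^sub>L 'k linf"
  assumes "T \<in> linf_operators"
    and "strictly_singular T"
  shows "is_commutator T"
proof -
  obtain V J :: "'k linf \<Rightarrow>\<^sub>L 'k linf" where VJ: "V \<in> linf_operators" "J \<in> linf_operators" "V o\<^sub>L J = id_blinfun"
    and decay: "\<And>x m. norm (apply_bcontfun (V (T x)) m) \<le> (1/2) ^ fst (prod_decode m) * norm x"
    by (rule strictly_singular_quotient_rows[OF assms, of "\<lambda>m. (1/2) ^ fst (prod_decode m)"]) auto
  show ?thesis
  proof (rule commutator_of_row_decay[OF assms(1) VJ])
    show "norm (apply_bcontfun (V (T x)) (prod_encode (k, n))) \<le> (1/2) ^ k * norm x" for x k n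
      using decay[of x "prod_encode (k, n)"] by simp
  qed
qed

end
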